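(* Let $d\ge 2$ and let $M=2$ or $M=d$. If a $d$-dimensional probability vector $\boldsymbol p$ satisfies $\max_k p_k\le 1/M$, then there exist $M$ perfectly distinguishable quantum states on $\mathbb{C}^d$ with the same classical version $\boldsymbol p$; that is, the condition $\max_k p_k\le 1/M$ (which is necessary) is also sufficient. Equivalently, $\mathcal{A}_d^2=\mathcal{P}_d^2$ and $\mathcal{A}_d^d=\mathcal{P}_d^d$.
   Context: Fix an orthonormal basis $\{|k\rangle\}_{k=1}^d$ of $\mathbb{C}^d$. A quantum state is a positive semidefinite $d\times d$ matrix $\rho$ with $\mathrm{Tr}\,\rho=1$. Its classical version is the probability vector $\boldsymbol p$ with $p_k=\langle k|\rho|k\rangle$. A set of states is perfectly distinguishable if the states have pairwise orthogonal supports (i.e. $\rho^{(m)}\rho^{(n)}=0$ for $m\ne n$). $\Delta_d$ is the set of $d$-dimensional probability vectors. The $M$-distinguishability region $\mathcal{A}_d^M\subseteq\Delta_d$ is the set of all $\boldsymbol p\in\Delta_d$ for which there exist $M$ perfectly distinguishable quantum states all having classical version $\boldsymbol p$. $\boldsymbol v^M\in\Delta_d$ is the vector whose first $M$ entries equal $1/M$ and whose other entries are $0$. The permutohedron $\mathcal{P}_d^M$ is the convex hull of all permutations of the coordinates of $\boldsymbol v^M$. *)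

theory Defs
  imports "HOL-Analysis.Analysis"
begin

text \<open>
  \<open>\<complex>\<^sup>d\<close> is \<^typ>\<open>complex ^ 'n\<close> with \<open>d = CARD('n)\<close>. The class-level inner product on this type
  is real-valued, so the sesquilinear one (antilinear in the first argument) is defined here.
\<close>

definition braket :: "complex ^ 'n \<Rightarrow> complex ^ 'n \<Rightarrow> complex" where
  "braket u v = (\<Sum>i\<in>UNIV. cnj (u $ i) * v $ i)"

definition orthonormal_basis :: "('n \<Rightarrow> complex ^ 'n) \<Rightarrow> bool" where
  "orthonormal_basis e \<longleftrightarrow>
     (\<forall>i j. braket (e i) (e j) = (if i = j then 1 else 0)) \<and> vec.span (range e) = UNIV"

definition hermitian :: "complex ^ 'n ^ 'n \<Rightarrow> bool" where
  "hermitian A \<longleftrightarrow> (\<forall>i j. A $ i $ j = cnj (A $ j $ i))"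

text \<open>For Hermitian \<open>A\<close> the quadratic form is real, so taking \<^const>\<open>Re\<close> loses nothing, here and
  in \<open>classical_version\<close> below.\<close>

definition positive_semidefinite :: "complex ^ 'n ^ 'n \<Rightarrow> bool" where
  "positive_semidefinite A \<longleftrightarrow> hermitian A \<and> (\<forall>v. 0 \<le> Re (braket v (A *v v)))"

definition quantum_state :: "complex ^ 'n ^ 'n \<Rightarrow> bool" where
  "quantum_state \<rho> \<longleftrightarrow> positive_semidefinite \<rho> \<and> trace \<rho> = 1"

definition classical_version :: "('n \<Rightarrow> complex ^ 'n) \<Rightarrow> complex ^ 'n ^ 'n \<Rightarrow> real ^ 'n" where
  "classical_version e \<rho> = (\<chi> k. Re (braket (e k) (\<rho> *v e k)))"

text \<open>A collection of \<open>M\<close> states is a family indexed by \<open>{..<M}\<close>; values outside are irrelevant.\<close>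

definition perfectly_distinguishable :: "nat \<Rightarrow> (nat \<Rightarrow> complex ^ 'n ^ 'n) \<Rightarrow> bool" where
  "perfectly_distinguishable M \<rho> \<longleftrightarrow> (\<forall>m<M. \<forall>n<M. m \<noteq> n \<longrightarrow> \<rho> m ** \<rho> n = 0)"

definition prob_vectors :: "(real ^ 'n) set" where
  "prob_vectors = {p. (\<forall>k. 0 \<le> p $ k) \<and> (\<Sum>k\<in>UNIV. p $ k) = 1}"

definition distinguishability_region ::
    "('n \<Rightarrow> complex ^ 'n) \<Rightarrow> nat \<Rightarrow> (real ^ 'n) set" where
  "distinguishability_region e M =
     {p \<in> prob_vectors. \<exists>\<rho>. (\<forall>m<M. quantum_state (\<rho> m)) \<and> perfectly_distinguishable M \<rho> \<and>
        (\<forall>m<M. classical_version e (\<rho> m) = p)}"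

text \<open>\<open>k\<close> is among the first \<open>M\<close> indices iff fewer than \<open>M\<close> indices precede it.\<close>

definition v_vector :: "nat \<Rightarrow> real ^ 'n::{finite,linorder}" where
  "v_vector M = (\<chi> k. if card {j. j < k} < M then 1 / real M else 0)"

definition permutohedron :: "nat \<Rightarrow> (real ^ 'n::{finite,linorder}) set" where
  "permutohedron M = convex hull {(\<chi> k. v_vector M $ \<pi> k) | \<pi>. \<pi> permutes UNIV}"

end

theory Submission
  imports Defs
begin

text \<open>
  Necessity of \<open>p\<^sub>k \<le> 1/M\<close>: perfectly distinguishable states satisfy \<open>\<Sum>m<M. \<rho>\<^sub>m \<le> I\<close>.
  For sufficiency pure states are enough. If \<open>M = d\<close> then \<open>p\<close> is uniform and the Fourier basis works.
  If \<open>M = 2\<close>, the states with amplitudes \<open>\<surd>p\<^sub>k\<close> and \<open>\<surd>p\<^sub>k \<theta>\<^sub>k\<close>, with \<open>\<theta>\<^sub>k\<close> of modulus one, are orthogonal iff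
  \<open>\<Sum>p\<^sub>k \<theta>\<^sub>k = 0\<close>, i.e. iff the \<open>p\<^sub>k\<close> are the side lengths of a closed polygon, which is possible because
  no side exceeds half the perimeter. Finally, an extreme point of the polytope \<open>p\<^sub>k \<le> 1/M\<close> in the
  simplex has all coordinates in \<open>{0, 1/M}\<close>, since two others could be perturbed in opposite
  directions and a single one is excluded by the total being 1; by Krein-Milman the polytope is
  the permutohedron.
\<close>

section \<open>Algebra of the sesquilinear form\<close>

lemma braket_add_right: "braket u (v + w) = braket u v + braket u w"
  by (simp add: braket_def algebra_simps sum.distrib)

lemma braket_add_left: "braket (u + v) w = braket u w + braket v w"
  by (simp add: braket_def algebra_simps sum.distrib)

lemma braket_diff_right: "braket u (v - w) = braket u v - braket u w"
  by (simp add: braket_def algebra_simps sum_subtractf)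

lemma braket_diff_left: "braket (u - v) w = braket u w - braket v w"
  by (simp add: braket_def algebra_simps sum_subtractf)

lemma braket_scale_right: "braket u (a *s v) = a * braket u v"
  by (simp add: braket_def sum_distrib_left algebra_simps)

lemma braket_scale_left: "braket (a *s u) v = cnj a * braket u v"
  by (simp add: braket_def sum_distrib_left algebra_simps)

lemma braket_zero_right [simp]: "braket u 0 = 0"
  by (simp add: braket_def)

lemma braket_zero_left [simp]: "braket 0 u = 0"
  by (simp add: braket_def)

lemma braket_sum_right: "braket u (\<Sum>i\<in>I. f i) = (\<Sum>i\<in>I. braket u (f i))"
  by (induction I rule: infinite_finite_induct) (simp_all add: braket_add_right)

lemma braket_sum_left: "braket (\<Sum>i\<in>I. f i) u = (\<Sum>i\<in>I. braket (f i) u)"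
  by (induction I rule: infinite_finite_induct) (simp_all add: braket_add_left)

lemma cnj_braket: "cnj (braket u v) = braket v u"
  by (simp add: braket_def mult.commute)

lemma Re_braket_self: "Re (braket u u) = (\<Sum>i\<in>UNIV. (cmod (u $ i))\<^sup>2)"
  by (simp add: braket_def cmod_power2) (simp add: power2_eq_square)

lemma braket_self_nonneg: "0 \<le> Re (braket u u)"
  by (simp add: Re_braket_self sum_nonneg)

lemma braket_axis_left: "braket (axis i 1) v = v $ i"
  by (simp add: braket_def axis_def if_distrib[of cnj] if_distrib[of "\<lambda>x. x * _"] cong: if_cong)

section \<open>Positive semidefinite matrices and the bound on sums of distinguishable
  states\<close>

lemma hermitian_braket:
  assumes "hermitian A"
  shows "braket (A *v u) v = braket u (A *v v)"
proof -
  have "braket (A *v u) v = (\<Sum>i\<in>UNIV. \<Sum>j\<in>UNIV. cnj (A $ i $ j) * cnj (u $ j) * v $ i)"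
    by (simp add: braket_def matrix_vector_mult_def sum_distrib_right)
  also have "\<dots> = (\<Sum>j\<in>UNIV. \<Sum>i\<in>UNIV. cnj (A $ i $ j) * cnj (u $ j) * v $ i)"
    by (rule sum.swap)
  also have "\<dots> = (\<Sum>j\<in>UNIV. \<Sum>i\<in>UNIV. cnj (u $ j) * (A $ j $ i * v $ i))"
  proof (intro sum.cong refl)
    fix i j
    have "cnj (A $ i $ j) = A $ j $ i"
      using assms by (metis hermitian_def)
    then show "cnj (A $ i $ j) * cnj (u $ j) * v $ i = cnj (u $ j) * (A $ j $ i * v $ i)"
      by simp
  qed
  also have "\<dots> = braket u (A *v v)"
    by (simp add: braket_def matrix_vector_mult_def sum_distrib_left)
  finally show ?thesis .
qed

text \<open>The nonnegative form of \<open>A\<close> is expanded at \<open>u + t *s v\<close> and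
  \<open>t\<close> is chosen to make the result small. The form may be degenerate, so
  \<open>qv = 0\<close> is a separate case.\<close>

lemma positive_semidefinite_Cauchy_Schwarz:
  assumes "positive_semidefinite A"
  shows "(cmod (braket u (A *v v)))\<^sup>2 \<le> Re (braket u (A *v u)) * Re (braket v (A *v v))"
proof -
  define c where "c = braket u (A *v v)"
  define qu where "qu = Re (braket u (A *v u))"
  define qv where "qv = Re (braket v (A *v v))"
  have herm: "hermitian A" and pos: "\<And>v. 0 \<le> Re (braket v (A *v v))"
    using assms by (auto simp: positive_semidefinite_def)
  have vu: "braket v (A *v u) = cnj c"
    unfolding c_def cnj_braket using hermitian_braket[OF herm, of v u] by simp
  have ineq: "0 \<le> qu - 2 * s * (cmod c)\<^sup>2 + s\<^sup>2 * (cmod c)\<^sup>2 * qv" for s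
  proof -
    \<comment> \<open>The factor \<open>cnj c\<close> makes the cross terms \<open>t * c\<close> and
      \<open>cnj t * cnj c\<close> real and equal, leaving a real quadratic in
      \<open>s\<close>.\<close>
    define t where "t = - (of_real s * cnj c)"
    have "braket (u + t *s v) (A *v (u + t *s v)) =
        braket u (A *v u) + t * c + cnj t * cnj c + (cnj t * t) * braket v (A *v v)"
      by (simp add: matrix_vector_right_distrib vec.scale braket_add_left braket_add_right
          braket_scale_left braket_scale_right vu c_def[symmetric] algebra_simps)
    moreover have "t * c = of_real (- s * (cmod c)\<^sup>2)" "cnj t * cnj c = of_real (- s * (cmod c)\<^sup>2)"
      "cnj t * t = of_real (s\<^sup>2 * (cmod c)\<^sup>2)"
      unfolding cmod_power2 t_def
      by (simp_all add: complex_eq_iff power2_eq_square algebra_simps)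
    ultimately have "Re (braket (u + t *s v) (A *v (u + t *s v))) =
        qu - 2 * s * (cmod c)\<^sup>2 + s\<^sup>2 * (cmod c)\<^sup>2 * qv"
      by (simp add: qu_def qv_def)
    then show ?thesis
      using pos by metis
  qed
  have "(cmod c)\<^sup>2 \<le> qu * qv"
  proof (cases "qv = 0")
    case True
    have "(cmod c)\<^sup>2 = 0"
    proof (rule ccontr)
      assume "(cmod c)\<^sup>2 \<noteq> 0"
      \<comment> \<open>With \<open>qv = 0\<close> the bound is linear in \<open>s\<close>; this
        value of \<open>s\<close> turns it into \<open>0 \<le> qu - (qu + 1)\<close>.\<close>
      then show False
        using ineq[of "(qu + 1) / (2 * (cmod c)\<^sup>2)"] True by (simp add: field_simps)
    qed
    then show ?thesis using True by simp
  next
    case False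
    then have "qv > 0" using pos[of v] by (simp add: qv_def)
    then show ?thesis
      \<comment> \<open>\<open>s = 1 / qv\<close> minimises the quadratic.\<close>
      using ineq[of "1 / qv"] by (simp add: field_simps power2_eq_square)
  qed
  then show ?thesis by (simp add: c_def qu_def qv_def)
qed

text \<open>This is the operator inequality \<open>\<rho>\<^sup>2 \<le> \<rho>\<close>.
  Cauchy-Schwarz against each axis vector bounds the squared coordinates of
  \<open>\<rho> *v v\<close> by multiples of the diagonal entries, which sum to the trace 1.\<close>

lemma quantum_state_square_le:
  assumes "quantum_state \<rho>"
  shows "Re (braket (\<rho> *v v) (\<rho> *v v)) \<le> Re (braket v (\<rho> *v v))"
proof -
  have psd: "positive_semidefinite \<rho>" and tr: "trace \<rho> = 1"
    using assms by (auto simp: quantum_state_def)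
  have diag: "braket (axis i 1) (\<rho> *v axis i 1) = \<rho> $ i $ i" for i
    unfolding braket_axis_left
    by (simp add: matrix_vector_mult_def axis_def if_distrib[of "\<lambda>x. _ * x"] cong: if_cong)
  have "Re (braket (\<rho> *v v) (\<rho> *v v)) = (\<Sum>i\<in>UNIV. (cmod (braket (axis i 1) (\<rho> *v v)))\<^sup>2)"
    by (simp add: Re_braket_self braket_axis_left)
  also have "\<dots> \<le> (\<Sum>i\<in>UNIV. Re (\<rho> $ i $ i) * Re (braket v (\<rho> *v v)))"
    using positive_semidefinite_Cauchy_Schwarz[OF psd, of "axis _ 1" v]
    by (intro sum_mono) (simp add: diag)
  also have "\<dots> = Re (trace \<rho>) * Re (braket v (\<rho> *v v))"
    by (simp add: trace_def sum_distrib_right)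
  finally show ?thesis by (simp add: tr)
qed

text \<open>Orthogonality of the states gives \<open>\<parallel>w\<parallel>\<^sup>2 \<le> \<langle>v|w\<rangle>\<close> for \<open>w = (\<Sum>m<M. \<rho> m v)\<close>, so that
  \<open>0 \<le> \<parallel>v - w\<parallel>\<^sup>2\<close> bounds \<open>\<langle>v|w\<rangle>\<close>.\<close>

lemma distinguishable_sum_le:
  assumes states: "\<forall>m<M. quantum_state (\<rho> m)"
    and dist: "perfectly_distinguishable M \<rho>"
  shows "(\<Sum>m<M. Re (braket v (\<rho> m *v v))) \<le> Re (braket v v)"
proof -
  define w where "w = (\<Sum>m<M. \<rho> m *v v)"
  define s where "s = (\<Sum>m<M. Re (braket v (\<rho> m *v v)))"
  have vw: "Re (braket v w) = s"
    by (simp add: w_def s_def braket_sum_right)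
  have wv: "Re (braket w v) = s"
    using vw by (metis cnj_braket complex_cnj(1) complex.sel(1) cnj.sel(1))
  have cross: "braket (\<rho> m *v v) (\<rho> n *v v) = 0" if "m < M" "n < M" "m \<noteq> n" for m n
  proof -
    have "hermitian (\<rho> m)"
      using states that by (auto simp: quantum_state_def positive_semidefinite_def)
    then have "braket (\<rho> m *v v) (\<rho> n *v v) = braket v ((\<rho> m ** \<rho> n) *v v)"
      by (simp add: hermitian_braket matrix_vector_mul_assoc)
    also have "\<dots> = 0"
      using dist that by (simp add: perfectly_distinguishable_def)
    finally show ?thesis .
  qed
  have "braket w w = (\<Sum>m<M. \<Sum>n<M. braket (\<rho> m *v v) (\<rho> n *v v))"
    unfolding w_def braket_sum_left by (simp add: braket_sum_right)
  also have "\<dots> = (\<Sum>m<M. \<Sum>n<M. if n = m then braket (\<rho> m *v v) (\<rho> m *v v) else 0)"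
    using cross by (intro sum.cong refl) auto
  finally have "Re (braket w w) = (\<Sum>m<M. Re (braket (\<rho> m *v v) (\<rho> m *v v)))"
    by simp
  also have "\<dots> \<le> s"
    unfolding s_def using states by (intro sum_mono quantum_state_square_le) auto
  finally have "Re (braket w w) \<le> s" .
  moreover have "Re (braket (v - w) (v - w)) = Re (braket v v) - 2 * s + Re (braket w w)"
    by (simp add: braket_diff_left braket_diff_right vw wv)
  moreover have "0 \<le> Re (braket (v - w) (v - w))"
    by (rule braket_self_nonneg)
  ultimately show ?thesis unfolding s_def by linarith
qed

section \<open>Pure states with prescribed amplitudes\<close>

definition pure_state :: "complex ^ 'n \<Rightarrow> complex ^ 'n ^ 'n" where
  "pure_state \<psi> = (\<chi> i j. \<psi> $ i * cnj (\<psi> $ j))"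

lemma pure_state_mult_vec: "pure_state \<psi> *v v = braket \<psi> v *s \<psi>"
  by (simp add: pure_state_def matrix_vector_mult_def braket_def vec_eq_iff sum_distrib_left
      sum_distrib_right mult_ac)

lemma Re_braket_pure_state: "Re (braket v (pure_state \<psi> *v v)) = (cmod (braket v \<psi>))\<^sup>2"
proof -
  have "braket v (pure_state \<psi> *v v) = cnj (braket v \<psi>) * braket v \<psi>"
    by (simp add: pure_state_mult_vec braket_scale_right cnj_braket)
  then show ?thesis unfolding cmod_power2 by (simp add: power2_eq_square)
qed

lemma quantum_state_pure_state:
  assumes "braket \<psi> \<psi> = 1"
  shows "quantum_state (pure_state \<psi>)"
proof -
  have "hermitian (pure_state \<psi>)"
    by (simp add: hermitian_def pure_state_def)
  moreover have "trace (pure_state \<psi>) = braket \<psi> \<psi>"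
    by (simp add: trace_def pure_state_def braket_def mult.commute)
  ultimately show ?thesis
    using assms by (simp add: quantum_state_def positive_semidefinite_def Re_braket_pure_state)
qed

lemma pure_state_mult_eq_0:
  assumes "braket \<psi> \<phi> = 0"
  shows "pure_state \<psi> ** pure_state \<phi> = 0"
proof -
  have "(pure_state \<psi> ** pure_state \<phi>) $ i $ j = \<psi> $ i * braket \<psi> \<phi> * cnj (\<phi> $ j)" for i j
    by (simp add: pure_state_def matrix_matrix_mult_def braket_def sum_distrib_left
        sum_distrib_right mult_ac)
  then show ?thesis
    using assms by (simp add: vec_eq_iff)
qed

lemma braket_basis_sum:
  assumes "orthonormal_basis e"
  shows "braket (e k) (\<Sum>j\<in>UNIV. c j *s e j) = c k"
proof -
  have "braket (e k) (\<Sum>j\<in>UNIV. c j *s e j) = (\<Sum>j\<in>UNIV. if k = j then c j else 0)"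
    using assms unfolding braket_sum_right
    by (intro sum.cong) (auto simp: orthonormal_basis_def braket_scale_right)
  then show ?thesis by simp
qed

lemma braket_sum_sum:
  assumes "orthonormal_basis e"
  shows "braket (\<Sum>k\<in>UNIV. c k *s e k) (\<Sum>j\<in>UNIV. d j *s e j) = (\<Sum>k\<in>UNIV. cnj (c k) * d k)"
  by (simp add: braket_sum_left braket_scale_left braket_basis_sum[OF assms])

text \<open>Reduces sufficiency to a search for scalars: the pure states of the vectors with
  coefficients \<open>c m k\<close> in the basis \<open>e\<close> inherit normalisation and
  classical version from the moduli, and distinguishability from the orthogonality of the
  coefficient families.\<close>

lemma distinguishable_states_of_amplitudes:
  assumes e: "orthonormal_basis e"
    and p: "p \<in> prob_vectors"
    and amp: "\<And>m k. m < M \<Longrightarrow> (cmod (c m k))\<^sup>2 = p $ k"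
    and orth: "\<And>m n. m < M \<Longrightarrow> n < M \<Longrightarrow> m \<noteq> n \<Longrightarrow> (\<Sum>k\<in>UNIV. cnj (c m k) * c n k) = 0"
  shows "\<exists>\<rho>. (\<forall>m<M. quantum_state (\<rho> m)) \<and> perfectly_distinguishable M \<rho> \<and>
               (\<forall>m<M. classical_version e (\<rho> m) = p)"
proof (intro exI conjI)
  define \<psi> where "\<psi> m = (\<Sum>k\<in>UNIV. c m k *s e k)" for m
  let ?\<rho> = "\<lambda>m. pure_state (\<psi> m)"
  show "\<forall>m<M. quantum_state (?\<rho> m)"
  proof (intro allI impI quantum_state_pure_state)
    fix m assume m: "m < M"
    have "braket (\<psi> m) (\<psi> m) = (\<Sum>k\<in>UNIV. cnj (c m k) * c m k)"
      by (simp add: \<psi>_def braket_sum_sum[OF e])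
    also have "\<dots> = (\<Sum>k\<in>UNIV. of_real (p $ k))"
      using amp[OF m] by (intro sum.cong refl) (metis complex_norm_square mult.commute)
    also have "\<dots> = of_real (\<Sum>k\<in>UNIV. p $ k)"
      by simp
    also have "(\<Sum>k\<in>UNIV. p $ k) = 1"
      using p by (simp add: prob_vectors_def)
    finally show "braket (\<psi> m) (\<psi> m) = 1"
      by simp
  qed
  show "perfectly_distinguishable M ?\<rho>"
    unfolding perfectly_distinguishable_def
    by (intro allI impI pure_state_mult_eq_0) (simp add: \<psi>_def braket_sum_sum[OF e] orth)
  show "\<forall>m<M. classical_version e (?\<rho> m) = p"
    by (simp add: classical_version_def Re_braket_pure_state \<psi>_def braket_basis_sum[OF e] amp
        vec_eq_iff)
qed

section \<open>Closed polygons and the case of two states\<close>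

text \<open>The modulus of \<open>a + b * cis t\<close> varies continuously from
  \<open>a + b\<close> at 0 to \<open>\<bar>a - b\<bar>\<close> at \<open>pi\<close>, so it equals
  \<open>c\<close> somewhere between; the third side then closes the triangle.\<close>

lemma triangle_phases:
  fixes a b c :: real
  assumes "0 \<le> a" "0 \<le> b" "0 \<le> c" "a \<le> b + c" "b \<le> a + c" "c \<le> a + b"
  obtains \<alpha> \<beta> \<gamma> where "cmod \<alpha> = 1" "cmod \<beta> = 1" "cmod \<gamma> = 1"
    "of_real a * \<alpha> + of_real b * \<beta> + of_real c * \<gamma> = 0"
proof -
  define g where "g t = cmod (of_real a + of_real b * cis t)" for t
  have g0: "g 0 = a + b"
    using assms by (simp add: g_def flip: of_real_add)
  have gpi: "g pi = \<bar>a - b\<bar>"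
    by (simp add: g_def flip: of_real_diff)
  have "\<exists>t\<ge>0. t \<le> pi \<and> g t = c"
  proof (rule IVT2')
    show "continuous_on {0..pi} g"
      unfolding g_def cis_conv_exp by (intro continuous_intros)
  qed (use assms g0 gpi in auto)
  then obtain t where t: "g t = c" by blast
  define z where "z = of_real a + of_real b * cis t"
  have z: "cmod z = c"
    using t by (simp add: z_def g_def)
  show ?thesis
  \<comment> \<open>If \<open>c = 0\<close>, the quotient \<open>- z / c\<close> has no modulus one,
    but then \<open>z = 0\<close> and any third phase will do.\<close>
  proof (cases "c = 0")
    case True
    then show ?thesis using z that[of 1 "cis t" 1] by (simp add: z_def)
  next
    case False
    have "cmod (- z / of_real c) = 1"
      using z False assms(3) by (simp add: norm_divide)
    moreover have "of_real a * 1 + of_real b * cis t + of_real c * (- z / of_real c) = 0"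
      using False by (simp add: z_def)
    ultimately show ?thesis
      by (intro that[of 1 "cis t" "- z / of_real c"]) auto
  qed
qed

text \<open>The polygon inequality reduces to the triangle inequality: cut the sides, in the given order,
  at the first index where the partial sum reaches half the perimeter.\<close>

lemma polygon_phases:
  fixes p :: "real ^ 'n::{finite,linorder}"
  assumes p: "p \<in> prob_vectors" and le: "\<And>k. p $ k \<le> 1 / 2"
  obtains \<theta> where "\<And>k. cmod (\<theta> k) = 1" "(\<Sum>k\<in>UNIV. of_real (p $ k) * \<theta> k) = 0"
proof -
  have nn: "\<And>k. 0 \<le> p $ k" and sum1: "(\<Sum>k\<in>UNIV. p $ k) = 1"
    using p by (auto simp: prob_vectors_def)
  define T where "T = {t. 1 / 2 \<le> (\<Sum>k\<in>{..t}. p $ k)}"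
  have "{..Max (UNIV :: 'n set)} = UNIV"
    by auto
  then have "Max UNIV \<in> T"
    by (simp add: T_def sum1)
  define t where "t = Min T"
  have tT: "t \<in> T"
    unfolding t_def using \<open>Max UNIV \<in> T\<close> by (intro Min_in) auto
  define a where "a = (\<Sum>k\<in>{..<t}. p $ k)"
  define c where "c = (\<Sum>k\<in>{t<..}. p $ k)"
  have split: "(\<Sum>k\<in>UNIV. f k) = (\<Sum>k\<in>{..<t}. f k) + f t + (\<Sum>k\<in>{t<..}. f k)"
    for f :: "'n \<Rightarrow> 'b::comm_monoid_add"
  proof -
    have "UNIV = insert t {..<t} \<union> {t<..}"
      by auto
    then have "(\<Sum>k\<in>UNIV. f k) = (\<Sum>k\<in>insert t {..<t}. f k) + (\<Sum>k\<in>{t<..}. f k)"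
      by (metis (no_types, lifting) sum.union_disjoint finite disjoint_iff greaterThan_iff
          insert_iff lessThan_iff order_less_asym order_less_irrefl)
    then show ?thesis
      by (simp add: add.commute)
  qed
  have abc: "a + p $ t + c = 1"
    using split[of "\<lambda>k. p $ k"] sum1 by (simp add: a_def c_def)
  have "{..t} = insert t {..<t}"
    by auto
  then have "1 / 2 \<le> p $ t + a"
    using tT by (simp add: T_def a_def)
  \<comment> \<open>By minimality of \<open>t\<close>, the partial sum up to its predecessor
    \<open>Max {..<t}\<close>, which is \<open>a\<close>, stays below 1/2. Without a predecessor the
    sum is empty.\<close>
  moreover have "a \<le> 1 / 2"
  proof (cases "{..<t} = {}")
    case True
    then show ?thesis by (simp only: a_def) simp
  next
    case False
    then have "Max {..<t} < t"
      by (metis Max_in finite lessThan_iff)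
    moreover have "{..Max {..<t}} = {..<t}"
      using \<open>Max {..<t} < t\<close> by (fastforce intro: Max_ge)
    moreover have "Max {..<t} \<notin> T"
      using \<open>Max {..<t} < t\<close> unfolding t_def by (meson Min_le finite leD)
    ultimately show ?thesis
      by (simp add: T_def a_def)
  qed
  moreover have "0 \<le> a" "0 \<le> c"
    by (simp_all add: a_def c_def sum_nonneg nn)
  moreover have "0 \<le> p $ t" "p $ t \<le> 1 / 2"
    using nn le by auto
  \<comment> \<open>For perimeter 1 the triangle inequalities say that no side exceeds 1/2. For
    \<open>c\<close> this follows from \<open>1 / 2 \<le> p $ t + a\<close>.\<close>
  ultimately obtain \<alpha> \<beta> \<gamma> where norms: "cmod \<alpha> = 1" "cmod \<beta> = 1" "cmod \<gamma> = 1"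
    and eq: "of_real a * \<alpha> + of_real (p $ t) * \<beta> + of_real c * \<gamma> = 0"
    using abc by (elim triangle_phases[of a "p $ t" c, rotated -1]) linarith+
  define \<theta> where "\<theta> k = (if k < t then \<alpha> else if k = t then \<beta> else \<gamma>)" for k
  have "(\<Sum>k\<in>{..<t}. of_real (p $ k) * \<theta> k) = of_real a * \<alpha>"
    "(\<Sum>k\<in>{t<..}. of_real (p $ k) * \<theta> k) = of_real c * \<gamma>"
    by (auto simp: \<theta>_def a_def c_def sum_distrib_right intro!: sum.cong)
  then have "(\<Sum>k\<in>UNIV. of_real (p $ k) * \<theta> k) = 0"
    using eq by (subst split) (simp add: \<theta>_def)
  moreover have "cmod (\<theta> k) = 1" for k
    by (simp add: \<theta>_def norms)
  ultimately show ?thesis using that by blast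
qed

lemma two_distinguishable_states:
  fixes e :: "'n \<Rightarrow> complex ^ 'n::{finite,linorder}"
  assumes e: "orthonormal_basis e" and p: "p \<in> prob_vectors" and le: "\<And>k. p $ k \<le> 1 / 2"
  shows "\<exists>\<rho>. (\<forall>m<2. quantum_state (\<rho> m)) \<and> perfectly_distinguishable 2 \<rho> \<and>
               (\<forall>m<2. classical_version e (\<rho> m) = p)"
proof -
  obtain \<theta> where \<theta>: "\<And>k. cmod (\<theta> k) = 1" "(\<Sum>k\<in>UNIV. of_real (p $ k) * \<theta> k) = 0"
    using polygon_phases[OF p le] by blast
  have nn: "\<And>k. 0 \<le> p $ k"
    using p by (auto simp: prob_vectors_def)
  define c where "c m k = of_real (sqrt (p $ k)) * (if m = 0 then 1 else \<theta> k)" for m :: nat and k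
  have sq: "complex_of_real (sqrt (p $ k)) * of_real (sqrt (p $ k)) = of_real (p $ k)" for k
    using nn by (simp flip: of_real_mult)
  have "(\<Sum>k\<in>UNIV. cnj (c 0 k) * c 1 k) = 0"
    using \<theta>(2) by (simp add: c_def sq flip: mult.assoc)
  \<comment> \<open>Orthogonality in the other order follows by conjugation.\<close>
  moreover have "(\<Sum>k\<in>UNIV. cnj (c 1 k) * c 0 k) = cnj (\<Sum>k\<in>UNIV. cnj (c 0 k) * c 1 k)"
    by (simp add: mult.commute)
  ultimately have "(\<Sum>k\<in>UNIV. cnj (c m k) * c n k) = 0" if "m < 2" "n < 2" "m \<noteq> n" for m n
    using that by (auto simp: less_2_cases_iff)
  moreover have "(cmod (c m k))\<^sup>2 = p $ k" for m k
    using nn by (simp add: c_def norm_mult \<theta>)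
  ultimately show ?thesis
    by (intro distinguishable_states_of_amplitudes[OF e p]) auto
qed

section \<open>The Fourier basis and the case of d states\<close>

lemma uniform_distinguishable_states:
  fixes e :: "'n::finite \<Rightarrow> complex ^ 'n"
  assumes e: "orthonormal_basis e" and p: "p \<in> prob_vectors" and le: "\<And>k. p $ k \<le> 1 / CARD('n)"
  shows "\<exists>\<rho>. (\<forall>m<CARD('n). quantum_state (\<rho> m)) \<and> perfectly_distinguishable CARD('n) \<rho> \<and>
               (\<forall>m<CARD('n). classical_version e (\<rho> m) = p)"
proof -
  define d where "d = CARD('n)"
  have d: "d > 0" by (simp add: d_def)
  have unif: "p $ k = 1 / d" for k
  proof -
    \<comment> \<open>The gaps below the cap are nonnegative and sum to 0, so all of them
      vanish.\<close>
    have "(\<Sum>k\<in>UNIV. 1 / d - p $ k) = 0"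
      using p d by (simp add: prob_vectors_def sum_subtractf flip: d_def)
    then have "\<forall>k\<in>UNIV. 1 / d - p $ k = 0"
      using le by (subst (asm) sum_nonneg_eq_0_iff) (auto simp: d_def)
    then show ?thesis by simp
  qed
  \<comment> \<open>The index type has no arithmetic, so \<open>r\<close> numbers it by 0 to
    \<open>d - 1\<close> to supply the exponents of the Fourier matrix.\<close>
  obtain r where r: "bij_betw r (UNIV :: 'n set) {..<d}"
    using ex_bij_betw_finite_nat[of "UNIV :: 'n set"] by (auto simp: d_def atLeast0LessThan)
  define w where "w m = exp (2 * of_real pi * \<i> * of_nat m / of_nat d)" for m
  have normw: "cmod (w m) = 1" for m
    by (simp add: w_def norm_exp_eq_Re)
  have wd: "w m ^ d = 1" for m
    using complex_root_unity[of d m] d by (simp add: w_def)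
  define c where "c m k = w m ^ r k / of_real (sqrt d)" for m k
  have "(cmod (c m k))\<^sup>2 = p $ k" for m k
    by (simp add: c_def norm_divide norm_power normw unif power_divide)
  moreover have "(\<Sum>k\<in>UNIV. cnj (c m k) * c n k) = 0" if "m < d" "n < d" "m \<noteq> n" for m n
  proof -
    \<comment> \<open>As \<open>w m\<close> has modulus one, \<open>z\<close> is the ratio of
      \<open>w n\<close> to \<open>w m\<close>: a d-th root of unity other than 1, whose powers
      below \<open>d\<close> sum to 0.\<close>
    define z where "z = cnj (w m) * w n"
    have "w m * z = w n"
      using normw[of m] by (simp add: z_def complex_norm_square[symmetric] flip: mult.assoc)
    moreover have "w m \<noteq> w n"
      using that complex_root_unity_eq[of d m n] d by (simp add: w_def cong_def)
    ultimately have "z \<noteq> 1" by auto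
    have "cnj (c m k) * c n k = z ^ r k / of_nat d" for k
    proof -
      have "complex_of_real (sqrt d) * of_real (sqrt d) = of_nat d"
        by (simp flip: of_real_mult)
      then show ?thesis
        by (simp add: c_def z_def power_mult_distrib)
    qed
    then have "(\<Sum>k\<in>UNIV. cnj (c m k) * c n k) = (\<Sum>k\<in>UNIV. z ^ r k) / of_nat d"
      by (simp add: sum_divide_distrib)
    also have "(\<Sum>k\<in>UNIV. z ^ r k) = (\<Sum>j<d. z ^ j)"
      by (rule sum.reindex_bij_betw[OF r])
    also have "\<dots> = 0"
      using \<open>z \<noteq> 1\<close> wd[of m] wd[of n]
      by (simp add: geometric_sum z_def[symmetric])
        (simp add: z_def power_mult_distrib flip: complex_cnj_power)
    finally show ?thesis by simp
  qed
  ultimately show ?thesis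
    by (intro distinguishable_states_of_amplitudes[OF e p, of _ c]) (auto simp: d_def)
qed

section \<open>Vertices of the permutohedron\<close>

text \<open>Counting predecessors is strictly monotone, hence a bijection from the index type onto
  the numbers below its cardinality. It follows that \<open>v_vector M\<close> has exactly
  \<open>M\<close> nonzero entries.\<close>

lemma card_initial_segment:
  assumes "M \<le> CARD('n::{finite,linorder})"
  shows "card {k :: 'n::{finite,linorder}. card {j. j < k} < M} = M"
proof -
  let ?r = "\<lambda>k :: 'n. card {j. j < k}"
  have mono: "?r k < ?r l" if "k < l" for k l
    using that by (intro psubset_card_mono) auto
  have inj: "inj ?r"
    by (rule linorder_injI) (use mono in fastforce)
  have "?r k < CARD('n)" for k
    by (intro psubset_card_mono) auto
  then have "range ?r = {..<CARD('n)}"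
    using inj by (intro card_subset_eq) (auto simp: card_image)
  then have "?r ` {k. ?r k < M} = {..<M}"
    using assms by (auto simp: image_iff set_eq_iff) (metis order_less_le_trans)
  then show ?thesis
    using card_image[of ?r "{k. ?r k < M}"] inj by (auto simp: inj_on_def)
qed

text \<open>Glues a bijection from \<open>S\<close> to \<open>T\<close> with one between the
  complements. Composing the indicator of \<open>T\<close> with \<open>\<pi>\<close> gives that of
  \<open>S\<close>, which is how a 0-or-\<open>1 / M\<close> vector is recognised as a rearrangement
  of \<open>v_vector M\<close>.\<close>

lemma ex_permutation_vimage:
  fixes S T :: "'n::finite set"
  assumes "card S = card T"
  obtains \<pi> where "\<pi> permutes UNIV" "\<And>k. \<pi> k \<in> T \<longleftrightarrow> k \<in> S"
proof -
  obtain f where f: "bij_betw f S T"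
    using assms finite_same_card_bij[of S T] by auto
  have "card (- S) = card (- T)"
    using assms by (simp add: Compl_eq_Diff_UNIV card_Diff_subset)
  then obtain g where g: "bij_betw g (- S) (- T)"
    using finite_same_card_bij[of "- S" "- T"] by auto
  define \<pi> where "\<pi> k = (if k \<in> S then f k else g k)" for k
  have "bij_betw \<pi> S T \<longleftrightarrow> bij_betw f S T" "bij_betw \<pi> (- S) (- T) \<longleftrightarrow> bij_betw g (- S) (- T)"
    by (rule bij_betw_cong, simp add: \<pi>_def)+
  with f g have "bij_betw \<pi> S T" "bij_betw \<pi> (- S) (- T)"
    by auto
  then have "bij_betw \<pi> (S \<union> - S) (T \<union> - T)"
    by (rule bij_betw_combine) simp
  then have "\<pi> permutes UNIV"
    by (intro bij_imp_permutes) auto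
  moreover have "\<pi> k \<in> T \<longleftrightarrow> k \<in> S" for k
    using f g by (auto simp: \<pi>_def bij_betw_def)
  ultimately show ?thesis using that by blast
qed

lemma capped_extreme_point_values:
  fixes x :: "real ^ 'n::finite"
  assumes M: "M > 0"
    and x: "x extreme_point_of {p \<in> prob_vectors. \<forall>k. p $ k \<le> 1 / real M}"
  shows "x $ k = 0 \<or> x $ k = 1 / M"
proof (rule ccontr)
  assume k: "\<not> (x $ k = 0 \<or> x $ k = 1 / M)"
  let ?Q = "{p \<in> prob_vectors. \<forall>k. p $ k \<le> 1 / real M} :: (real ^ 'n) set"
  have xQ: "x \<in> ?Q" and not_between: "\<And>a b. a \<in> ?Q \<Longrightarrow> b \<in> ?Q \<Longrightarrow> x \<notin> open_segment a b"
    using x by (auto simp: extreme_point_of_def)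
  have bnd: "0 \<le> x $ j" "x $ j \<le> 1 / M" for j
    using xQ by (auto simp: prob_vectors_def)
  have sum1: "(\<Sum>j\<in>UNIV. x $ j) = 1"
    using xQ by (auto simp: prob_vectors_def)
  obtain l where l: "l \<noteq> k" "x $ l \<noteq> 0" "x $ l \<noteq> 1 / M"
  proof -
    \<comment> \<open>If \<open>k\<close> were the only such coordinate, with \<open>n\<close>
      others equal to \<open>1 / M\<close>, then \<open>M * x $ k = M - n\<close> would be an
      integer strictly between 0 and 1.\<close>
    have False if all: "\<forall>l. l \<noteq> k \<longrightarrow> x $ l = 0 \<or> x $ l = 1 / M"
    proof -
      define n where "n = card {l. l \<noteq> k \<and> x $ l \<noteq> 0}"
      have "(\<Sum>j\<in>UNIV. x $ j) = x $ k + (\<Sum>j\<in>UNIV - {k}. x $ j)"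
        by (simp add: sum.remove)
      also have "(\<Sum>j\<in>UNIV - {k}. x $ j) = (\<Sum>j\<in>{l. l \<noteq> k \<and> x $ l \<noteq> 0}. x $ j)"
        by (rule sum.mono_neutral_right) auto
      also have "\<dots> = (\<Sum>j\<in>{l. l \<noteq> k \<and> x $ l \<noteq> 0}. 1 / M)"
        using all by (intro sum.cong) auto
      also have "\<dots> = n / M"
        by (simp add: n_def)
      finally have "M * x $ k = real M - real n"
        using sum1 M by (simp add: field_simps)
      moreover have "0 < M * x $ k" "M * x $ k < 1"
        using k bnd[of k] M less_le[of 0 "x $ k"] less_le[of "x $ k" "1 / M"]
        by (simp_all add: pos_less_divide_eq mult.commute)
      ultimately have "real n < real M" "real M < real (n + 1)"
        by simp_all
      then show False
        unfolding of_nat_less_iff by simp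
    qed
    then show ?thesis using that by blast
  qed
  \<comment> \<open>The largest amount that can be moved between \<open>k\<close> and
    \<open>l\<close> in either direction with both coordinates staying in the interval from 0 to
    \<open>1 / M\<close>; \<open>x\<close> is the midpoint of the two results.\<close>
  define \<epsilon> where "\<epsilon> = Min {x $ k, x $ l, 1 / M - x $ k, 1 / M - x $ l}"
  have eps: "0 < \<epsilon>" "\<epsilon> \<le> x $ k" "\<epsilon> \<le> x $ l" "\<epsilon> \<le> 1 / M - x $ k" "\<epsilon> \<le> 1 / M - x $ l"
    using k l bnd[of k] bnd[of l] by (auto simp: \<epsilon>_def less_le)
  define y where "y = axis k \<epsilon> - axis l \<epsilon>"
  have y: "y $ j = (if j = k then \<epsilon> else if j = l then - \<epsilon> else 0)" for j
    using l by (auto simp: y_def axis_def)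
  have sumy: "(\<Sum>j\<in>UNIV. y $ j) = 0"
    by (simp add: y_def axis_def sum_subtractf)
  have "x + y \<in> ?Q" "x - y \<in> ?Q"
    using eps bnd sum1 sumy
    by (auto simp: prob_vectors_def sum.distrib sum_subtractf y algebra_simps add_increasing2
        intro: order_trans[of _ "x $ _"])
  moreover have "(x + y) $ k \<noteq> (x - y) $ k"
    using y[of k] eps by simp
  then have "x + y \<noteq> x - y"
    by metis
  moreover have "midpoint (x + y) (x - y) = x"
    by (simp add: midpoint_def vec_eq_iff)
  ultimately show False
    using not_between[of "x + y" "x - y"] midpoint_in_open_segment[of "x + y" "x - y"]
    by metis
qed

text \<open>Replaces the hull by linear inequalities, so that the distinguishability region need
  only be compared with the cap on the coordinates. One inclusion is Krein-Milman applied to a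
  compact convex set, the other checks the generators.\<close>

lemma permutohedron_eq:
  assumes M: "M > 0" and Md: "M \<le> CARD('n::{finite,linorder})"
  shows "(permutohedron M :: (real ^ 'n::{finite,linorder}) set) =
    {p \<in> prob_vectors. \<forall>k. p $ k \<le> 1 / real M}"
    (is "_ = ?Q")
proof
  let ?V = "{(\<chi> k. v_vector M $ \<pi> k) | \<pi>. \<pi> permutes UNIV} :: ((real, 'n) vec) set"
  let ?T = "{k :: 'n. card {j. j < k} < M}"
  have T: "card ?T = M"
    using card_initial_segment[OF Md] .
  have Q: "?Q = (\<Inter>k. {p. 0 \<le> p $ k}) \<inter> {p. (\<Sum>k\<in>UNIV. p $ k) = 1} \<inter>
      (\<Inter>k. {p. p $ k \<le> 1 / real M})"
    by (auto simp: prob_vectors_def)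
  have convQ: "convex ?Q"
  proof (rule convexI)
    fix x y :: "(real, 'n) vec" and u v :: real
    assume *: "x \<in> ?Q" "y \<in> ?Q" "0 \<le> u" "0 \<le> v" "u + v = 1"
    then have "u * x $ k + v * y $ k \<le> 1 / M" for k
      by (intro convex_bound_le) auto
    moreover have "(\<Sum>k\<in>UNIV. u * x $ k + v * y $ k) = 1"
      using * by (simp add: prob_vectors_def sum.distrib flip: sum_distrib_left)
    ultimately show "u *\<^sub>R x + v *\<^sub>R y \<in> ?Q"
      using * by (simp add: prob_vectors_def)
  qed
  have "closed ?Q"
    unfolding Q
    by (intro closed_Int closed_INT ballI closed_Collect_le closed_Collect_eq continuous_intros)
  moreover have "?Q \<subseteq> cbox 0 1"
  proof
    fix p :: "(real, 'n) vec" assume p: "p \<in> ?Q"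
    have "1 / real M \<le> 1" using M by simp
    then have "p $ k \<le> 1" for k using p by (auto intro: order_trans)
    then show "p \<in> cbox 0 1" using p by (auto simp: mem_box_cart prob_vectors_def)
  qed
  ultimately have "compact ?Q"
    by (meson bounded_cbox bounded_subset compact_eq_bounded_closed)
  then have KM: "?Q = convex hull {x. x extreme_point_of ?Q}"
    using convQ by (rule Krein_Milman_Minkowski)
  have "x \<in> ?V" if x: "x extreme_point_of ?Q" for x
  proof -
    define S where "S = {k. x $ k = 1 / M}"
    have val: "x $ k = (if k \<in> S then 1 / M else 0)" for k
      using capped_extreme_point_values[OF M x] by (auto simp: S_def)
    have "(\<Sum>k\<in>UNIV. x $ k) = 1"
      using x by (auto simp: extreme_point_of_def prob_vectors_def)
    moreover have "(\<Sum>k\<in>UNIV. x $ k) = real (card S) / M"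
      by (simp add: val sum.If_cases)
    \<comment> \<open>Total mass 1 in portions of \<open>1 / M\<close> forces exactly
      \<open>M\<close> nonzero coordinates.\<close>
    ultimately have "card S = card ?T"
      using T by (metis divide_eq_1_iff of_nat_eq_iff)
    then obtain \<pi> where \<pi>: "\<pi> permutes UNIV" "\<And>k. \<pi> k \<in> ?T \<longleftrightarrow> k \<in> S"
      using ex_permutation_vimage by blast
    then have "x = (\<chi> k. v_vector M $ \<pi> k)"
      by (simp add: vec_eq_iff val v_vector_def)
    then show ?thesis using \<pi>(1) by blast
  qed
  then have "{x. x extreme_point_of ?Q} \<subseteq> ?V"
    by blast
  then show "?Q \<subseteq> permutohedron M"
    unfolding permutohedron_def by (subst KM) (rule hull_mono)
  have "?V \<subseteq> ?Q"
  proof clarify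
    fix \<pi> :: "'n \<Rightarrow> 'n" assume \<pi>: "\<pi> permutes UNIV"
    have "(\<Sum>k\<in>UNIV. v_vector M $ \<pi> k) = (\<Sum>k\<in>UNIV. (v_vector M :: (real, 'n) vec) $ k)"
      using \<pi> by (metis permutes_imp_bij sum.reindex_bij_betw)
    also have "\<dots> = 1"
      using T M by (simp add: v_vector_def sum.If_cases)
    finally show "(\<chi> k. v_vector M $ \<pi> k) \<in> prob_vectors \<and>
      (\<forall>k. (\<chi> k. v_vector M $ \<pi> k) $ k \<le> 1 / real M)"
      by (simp add: prob_vectors_def v_vector_def)
  qed
  then show "permutohedron M \<subseteq> ?Q"
    unfolding permutohedron_def using convQ by (rule hull_minimal)
qed

theorem proposition7:
  fixes e :: "'n \<Rightarrow> complex ^ 'n::{finite,linorder}" and M :: nat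
  assumes "orthonormal_basis e"
    and "CARD('n) \<ge> 2"
    and "M = 2 \<or> M = CARD('n)"
  shows "(\<forall>p\<in>prob_vectors.
            Max (range (\<lambda>k. p $ k)) \<le> 1 / real M \<longleftrightarrow>
            (\<exists>\<rho>.
               (\<forall>m<M. quantum_state (\<rho> m)) \<and> perfectly_distinguishable M \<rho> \<and>
               (\<forall>m<M. classical_version e (\<rho> m) = p)))
       \<and> distinguishability_region e M = permutohedron M"
proof -
  have M: "M > 0" "M \<le> CARD('n)"
    using assms(2,3) by auto
  have Max: "Max (range (\<lambda>k. p $ k)) \<le> c \<longleftrightarrow> (\<forall>k. p $ k \<le> c)" for p :: "(real, 'n) vec" and c
    by (subst Max_le_iff) auto
  \<comment> \<open>The operator bound is evaluated at \<open>e k\<close>, where each of the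
    \<open>M\<close> terms equals \<open>p $ k\<close> and the right-hand side is 1.\<close>
  have nec: "p $ k \<le> 1 / real M"
    if "\<forall>m<M. quantum_state (\<rho> m)" "perfectly_distinguishable M \<rho>"
      "\<forall>m<M. classical_version e (\<rho> m) = p" for p \<rho> k
  proof -
    have "p $ k = Re (braket (e k) (\<rho> m *v e k))" if "m < M" for m
      using \<open>\<forall>m<M. classical_version e (\<rho> m) = p\<close> that by (auto simp: classical_version_def)
    then have "real M * p $ k = (\<Sum>m<M. Re (braket (e k) (\<rho> m *v e k)))"
      by (metis (no_types, lifting) card_lessThan lessThan_iff sum.cong sum_constant)
    also have "\<dots> \<le> Re (braket (e k) (e k))"
      using that(1,2) by (rule distinguishable_sum_le)
    also have "\<dots> = 1"
      using assms(1) by (simp add: orthonormal_basis_def)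
    finally show ?thesis
      using M by (simp add: field_simps)
  qed
  have suff: "\<exists>\<rho>. (\<forall>m<M. quantum_state (\<rho> m)) \<and> perfectly_distinguishable M \<rho> \<and>
               (\<forall>m<M. classical_version e (\<rho> m) = p)"
    if "p \<in> prob_vectors" "\<forall>k. p $ k \<le> 1 / real M" for p
    using assms(3) two_distinguishable_states[OF assms(1) that(1)]
      uniform_distinguishable_states[OF assms(1) that(1)] that(2) by auto
  have iff: "(\<forall>k. p $ k \<le> 1 / real M) \<longleftrightarrow>
            (\<exists>\<rho>. (\<forall>m<M. quantum_state (\<rho> m)) \<and> perfectly_distinguishable M \<rho> \<and>
               (\<forall>m<M. classical_version e (\<rho> m) = p))" if "p \<in> prob_vectors" for p
    using suff[OF that] nec by blast
  then have "distinguishability_region e M = permutohedron M"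
    unfolding permutohedron_eq[OF M] distinguishability_region_def by auto
  with iff show ?thesis by (simp add: Max)
qed

end
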